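(* Let $d>2$ be a prime number, let $X\in M(d,\mathbb{C})$ be a unitary matrix with $X^d=\mathbb{I}_d$ and $\operatorname{Tr}(X^iX^{j\dagger})=0$ for all $i\neq j$ in $\{0,\dots,d-1\}$, and let $M_s$ be the $d$-dimensional subspace of $M(d,\mathbb{C})$ spanned by $\{X^0=\mathbb{I}_d,X^1,\dots,X^{d-1}\}$. Then the maximal number of Mutually Unbiased Unitary Bases (MUUBs) for $M_s$ is $d$; that is, there exist $d$ bases of $M_s$ which are pairwise MUUB, and there is no family of more than $d$ bases of $M_s$ which are pairwise MUUB.
   Context: $M(d,\mathbb{C})$ is the vector space of $d\times d$ complex matrices with inner product $(A,B)\mapsto\operatorname{Tr}(A^\dagger B)$, where $\dagger$ is the conjugate transpose; $\mathbb{I}_d$ is the identity matrix. Definition (MUUB): let $V$ be an $n$-dimensional subspace of $M(d,\mathbb{C})$. Two distinct orthogonal bases of $V$ consisting of unitary matrices, $A^{(0)}=\{A^{(0)}_0,\dots,A^{(0)}_{n-1}\}$ and $A^{(1)}=\{A^{(1)}_0,\dots,A^{(1)}_{n-1}\}$, are MUUB if there is a constant $C\neq 0$ such that $|\operatorname{Tr}(A_i^{(0)\dagger}A_j^{(1)})|^2=C$ for all $i,j=0,\dots,n-1$. A family of MUUBs is a family of orthogonal bases of $V$ consisting of unitary matrices that are pairwise MUUB. *)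

theory Defs
  imports "HOL-Analysis.Analysis" "HOL-Computational_Algebra.Primes"
begin

text \<open>
  Matrices in $M(d,\mathbb{C})$ are rendered as \<^typ>\<open>complex^'n^'n\<close> with $d$ = \<^term>\<open>CARD('n)\<close>.
  The overloaded \<^term>\<open>(*)\<close>, \<^term>\<open>1\<close> and \<^term>\<open>(^)\<close> are entrywise on this type; the matrix
  product is \<^term>\<open>(**)\<close> and the identity matrix is \<^term>\<open>mat 1\<close>.
\<close>

definition cadjoint :: "complex^'n^'m \<Rightarrow> complex^'m^'n"
  where "cadjoint A = map_matrix cnj (transpose A)"

definition unitary_mat :: "complex^'n^'n \<Rightarrow> bool"
  where "unitary_mat A \<longleftrightarrow> cadjoint A ** A = mat 1 \<and> A ** cadjoint A = mat 1"

primrec mat_pow :: "complex^'n^'n \<Rightarrow> nat \<Rightarrow> complex^'n^'n"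
  where
    "mat_pow A 0 = mat 1"
  | "mat_pow A (Suc k) = A ** mat_pow A k"

definition hs_inner :: "complex^'n^'n \<Rightarrow> complex^'n^'n \<Rightarrow> complex"
  where "hs_inner A B = trace (cadjoint A ** B)"

text \<open>
  The type class scalar multiplication on matrices is over the reals only, so the complex
  vector space structure (and hence \<open>cmat.span\<close>, \<open>cmat.independent\<close>, \<open>cmat.dim\<close>) is obtained
  by interpretation.
\<close>

definition cmat_scale :: "complex \<Rightarrow> complex^'n^'n \<Rightarrow> complex^'n^'n"
  where "cmat_scale c A = map_matrix ((*) c) A"

interpretation cmat: vector_space "cmat_scale :: complex \<Rightarrow> complex^'n^'n \<Rightarrow> complex^'n^'n"
  by unfold_locales (simp_all add: cmat_scale_def vec_eq_iff algebra_simps)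

definition orthogonal_unitary_basis :: "(complex^'n^'n) set \<Rightarrow> (complex^'n^'n) set \<Rightarrow> bool"
  where "orthogonal_unitary_basis V B \<longleftrightarrow>
    cmat.independent B \<and> cmat.span B = V \<and>
    (\<forall>A\<in>B. unitary_mat A) \<and>
    pairwise (\<lambda>A A'. hs_inner A A' = 0) B"

definition muub :: "(complex^'n^'n) set \<Rightarrow> (complex^'n^'n) set \<Rightarrow> (complex^'n^'n) set \<Rightarrow> bool"
  where "muub V B0 B1 \<longleftrightarrow>
    orthogonal_unitary_basis V B0 \<and> orthogonal_unitary_basis V B1 \<and> B0 \<noteq> B1 \<and>
    (\<exists>C::real. C \<noteq> 0 \<and> (\<forall>A\<in>B0. \<forall>A'\<in>B1. (cmod (hs_inner A A'))\<^sup>2 = C))"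

definition muub_family :: "(complex^'n^'n) set \<Rightarrow> (complex^'n^'n) set set \<Rightarrow> bool"
  where "muub_family V F \<longleftrightarrow>
    (\<forall>B\<in>F. orthogonal_unitary_basis V B) \<and> pairwise (muub V) F"

definition power_span :: "complex^'n^'n \<Rightarrow> (complex^'n^'n) set"
  where "power_span X = cmat.span (mat_pow X ` {..<CARD('n)})"

end

theory Submission
  imports Defs
begin

text \<open>
  The spectrum of \<open>X\<close> consists of all \<open>d\<close>-th roots of unity, each of multiplicity one, so the
  span of its powers is the algebra of diagonal matrices in an eigenbasis of \<open>X\<close>, and its
  unitaries are those with unimodular diagonals. The \<open>d\<close> bases with diagonals
  \<open>x \<mapsto> \<omega>^(k x^2 + j x)\<close>, one for each \<open>k < d\<close>, are mutually unbiased because a nondegenerate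
  quadratic Gauss sum has squared modulus \<open>d\<close>.

  For the upper bound, assign to a unitary with diagonal \<open>a\<close> the unimodular vector
  \<open>v(x, y) = a x * cnj (a y)\<close> on pairs \<open>x \<noteq> y\<close>; two such vectors have inner product
  \<open>\<bar>\<langle>a, b\<rangle>\<bar>^2 - d\<close>, which vanishes for members of unbiased bases. The sum of the squared entries of
  the Gram matrix is the same for the rows as for the columns of the array of all these vectors;
  keeping only the diagonal terms on the column side bounds the number of bases by \<open>d\<close>.
\<close>

section \<open>Additive characters modulo \<open>d\<close> and quadratic Gauss sums\<close>

text \<open>Integer arguments let conjugation become negation and let quotients of characters become
  differences.\<close>

definition root_char :: "nat \<Rightarrow> int \<Rightarrow> complex"
  where "root_char d k = cis (2 * pi * of_int k / of_nat d)"

lemma root_char_0 [simp]: "root_char d 0 = 1"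
  by (simp add: root_char_def)

lemma root_char_add: "root_char d (a + b) = root_char d a * root_char d b"
  by (simp add: root_char_def cis_mult add_divide_distrib distrib_left)

lemma norm_root_char [simp]: "cmod (root_char d a) = 1"
  by (simp add: root_char_def)

lemma cnj_root_char: "cnj (root_char d a) = root_char d (- a)"
  by (simp add: root_char_def cis_cnj)

lemma root_char_mult_nat: "root_char d (a * int k) = root_char d a ^ k"
  by (simp add: root_char_def Complex.DeMoivre mult_ac)

lemma root_char_eq_1_iff:
  assumes "d > 0"
  shows "root_char d a = 1 \<longleftrightarrow> int d dvd a"
proof -
  have "root_char d a = 1 \<longleftrightarrow> (\<exists>n::int. 2 * pi * of_int a / of_nat d = of_int (2 * n) * pi)"
    unfolding root_char_def cis_conv_exp exp_eq_1 by simp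
  also have "\<dots> \<longleftrightarrow> (\<exists>n::int. of_int a = (of_int (int d * n) :: real))"
    using assms by (simp add: field_simps)
  also have "\<dots> \<longleftrightarrow> int d dvd a"
    unfolding of_int_eq_iff by (simp add: dvd_def)
  finally show ?thesis .
qed

lemma root_char_period:
  assumes "d > 0" "int d dvd c"
  shows "root_char d (a + c) = root_char d a"
  using assms root_char_eq_1_iff by (simp add: root_char_add)

text \<open>A geometric series whose ratio is a \<open>d\<close>-th root of unity, equal to one
  exactly when \<open>d\<close> divides \<open>a\<close>.\<close>

lemma sum_root_char:
  assumes "d > 0"
  shows "(\<Sum>k<d. root_char d (a * int k)) = (if int d dvd a then of_nat d else 0)"
proof (cases "int d dvd a")
  case True
  then have "root_char d (a * int k) = 1" for k
    using root_char_eq_1_iff[OF assms] by simp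
  then show ?thesis using True by simp
next
  case False
  then have "root_char d a \<noteq> 1"
    using root_char_eq_1_iff[OF assms] by simp
  moreover have "root_char d a ^ d = 1"
    unfolding root_char_mult_nat[symmetric] using root_char_eq_1_iff[OF assms] by simp
  ultimately show ?thesis
    using False by (simp add: root_char_mult_nat geometric_sum)
qed

lemma sum_root_char_diff:
  assumes "x < d" "y < d"
  shows "(\<Sum>k<d. root_char d ((int x - int y) * int k)) = (if x = y then of_nat d else 0)"
proof -
  have "int d dvd int x - int y \<longleftrightarrow> x = y"
    using assms by (auto simp flip: mod_eq_dvd_iff)
  then show ?thesis using assms by (simp add: sum_root_char)
qed

text \<open>Advancing the window by one trades \<open>f t\<close> for the equal value
  \<open>f (t + d)\<close>.\<close>

lemma sum_periodic_shift:
  fixes f :: "int \<Rightarrow> 'a :: ab_group_add"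
  assumes "\<And>x. f (x + int d) = f x"
  shows "(\<Sum>x<d. f (int x + int t)) = (\<Sum>x<d. f (int x))"
proof (induction t)
  case (Suc t)
  define g where "g x = f (int x + int t)" for x
  have "(\<Sum>x<d. f (int x + int (Suc t))) = (\<Sum>x<d. g (Suc x))"
    by (simp add: g_def algebra_simps)
  also have "\<dots> = (\<Sum>x<d. g x) + g d - g 0"
    using sum.lessThan_Suc_shift[of g d] by (simp add: algebra_simps)
  also have "g d = g 0"
    using assms[of "int t"] by (simp add: g_def add.commute)
  finally show ?case using Suc by (simp add: g_def)
qed simp

text \<open>In the double sum for the squared modulus, replacing \<open>x\<close> by
  \<open>x + y\<close> cancels the terms in \<open>y^2\<close> and leaves a character sum over
  \<open>y\<close> with frequency \<open>2 * a * x\<close>. By coprimality it vanishes unless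
  \<open>x = 0\<close>.\<close>

lemma gauss_sum_norm:
  fixes a b :: int
  assumes d: "d > 0" and coprime: "coprime (int d) (2 * a)"
  shows "(cmod (\<Sum>x<d. root_char d (a * int x ^ 2 + b * int x)))\<^sup>2 = real d"
proof -
  define g where "g x = root_char d (a * x ^ 2 + b * x)" for x :: int
  have period: "g (x + int d) = g x" for x
  proof -
    have "a * (x + int d) ^ 2 + b * (x + int d)
        = a * x ^ 2 + b * x + int d * (2 * a * x + a * int d + b)"
      by (simp add: power2_eq_square algebra_simps)
    then show ?thesis
      using root_char_period[OF d] by (simp add: g_def)
  qed
  have "(\<Sum>x<d. g (int x)) * cnj (\<Sum>x<d. g (int x))
      = (\<Sum>y<d. cnj (g (int y)) * (\<Sum>x<d. g (int x)))"
    by (simp add: sum_distrib_left sum_distrib_right mult_ac)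
  also have "\<dots> = (\<Sum>y<d. cnj (g (int y)) * (\<Sum>x<d. g (int x + int y)))"
    using sum_periodic_shift[of g d, OF period] by simp
  also have "\<dots> = (\<Sum>x<d. \<Sum>y<d. g (int x + int y) * cnj (g (int y)))"
    by (subst sum.swap) (simp add: sum_distrib_left mult_ac)
  also have "\<dots> = (\<Sum>x<d. g (int x) * (\<Sum>y<d. root_char d (2 * a * int x * int y)))"
  proof -
    have "g (x + y) * cnj (g y) = g x * root_char d (2 * a * x * y)" for x y
      unfolding g_def cnj_root_char root_char_add[symmetric]
      by (rule arg_cong[of _ _ "root_char d"]) (simp add: power2_eq_square algebra_simps)
    then show ?thesis by (simp add: sum_distrib_left)
  qed
  also have "\<dots> = (\<Sum>x<d. if x = 0 then of_nat d else 0)"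
  proof (rule sum.cong)
    fix x assume "x \<in> {..<d}"
    moreover have "int d dvd 2 * a * int x \<longleftrightarrow> d dvd x"
      using coprime_dvd_mult_right_iff[OF coprime] by simp
    ultimately show "g (int x) * (\<Sum>y<d. root_char d (2 * a * int x * int y))
        = (if x = 0 then of_nat d else 0)"
      using d nat_dvd_not_less[of x d] by (auto simp: sum_root_char g_def)
  qed simp
  also have "\<dots> = of_nat d"
    using d by simp
  finally have "complex_of_real ((cmod (\<Sum>x<d. g (int x)))\<^sup>2) = of_real (real d)"
    by (simp add: complex_norm_square del: of_real_power)
  then show ?thesis
    unfolding of_real_eq_iff g_def .
qed

section \<open>Gram sums of unimodular vectors\<close>

text \<open>Expanding the squares gives a fourfold sum that is symmetric between rows and columns.
  On the column side all terms are nonnegative, and each diagonal one equals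
  \<open>(card I)^2\<close> by unimodularity.\<close>

lemma sum_cmod_gram_ge:
  fixes v :: "'i \<Rightarrow> 'p \<Rightarrow> complex"
  assumes fin: "finite I" "finite P" and unimod: "\<And>i p. i \<in> I \<Longrightarrow> p \<in> P \<Longrightarrow> cmod (v i p) = 1"
  shows "real (card P) * (real (card I))\<^sup>2
    \<le> (\<Sum>i\<in>I. \<Sum>j\<in>I. (cmod (\<Sum>p\<in>P. cnj (v i p) * v j p))\<^sup>2)"
proof -
  have "complex_of_real (\<Sum>i\<in>I. \<Sum>j\<in>I. (cmod (\<Sum>p\<in>P. cnj (v i p) * v j p))\<^sup>2)
      = (\<Sum>i\<in>I. \<Sum>j\<in>I. \<Sum>p\<in>P. \<Sum>q\<in>P. (cnj (v i p) * v j p) * (v i q * cnj (v j q)))"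
    by (simp add: complex_norm_square sum_product del: of_real_power)
  also have "\<dots> = (\<Sum>i\<in>I. \<Sum>p\<in>P. \<Sum>q\<in>P. \<Sum>j\<in>I. (cnj (v i p) * v j p) * (v i q * cnj (v j q)))"
    by (simp only: sum.swap[of _ P I])
  also have "\<dots> = (\<Sum>p\<in>P. \<Sum>q\<in>P. \<Sum>i\<in>I. \<Sum>j\<in>I. (cnj (v i p) * v i q) * (v j p * cnj (v j q)))"
    by (simp only: sum.swap[of _ P I] mult_ac)
  also have "\<dots> = complex_of_real (\<Sum>p\<in>P. \<Sum>q\<in>P. (cmod (\<Sum>i\<in>I. cnj (v i p) * v i q))\<^sup>2)"
    by (simp add: complex_norm_square sum_product del: of_real_power)
  finally have swap: "(\<Sum>i\<in>I. \<Sum>j\<in>I. (cmod (\<Sum>p\<in>P. cnj (v i p) * v j p))\<^sup>2)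
      = (\<Sum>p\<in>P. \<Sum>q\<in>P. (cmod (\<Sum>i\<in>I. cnj (v i p) * v i q))\<^sup>2)"
    unfolding of_real_eq_iff .
  have diag: "(cmod (\<Sum>i\<in>I. cnj (v i p) * v i p))\<^sup>2 = (real (card I))\<^sup>2" if "p \<in> P" for p
  proof -
    have "cnj (v i p) * v i p = 1" if "i \<in> I" for i
      using unimod[OF that \<open>p \<in> P\<close>] complex_norm_square[of "v i p"] by (simp add: mult.commute)
    then show ?thesis by simp
  qed
  have "real (card P) * (real (card I))\<^sup>2
      = (\<Sum>p\<in>P. (cmod (\<Sum>i\<in>I. cnj (v i p) * v i p))\<^sup>2)"
    using diag by simp
  also have "\<dots> \<le> (\<Sum>p\<in>P. \<Sum>q\<in>P. (cmod (\<Sum>i\<in>I. cnj (v i p) * v i q))\<^sup>2)"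
    using fin(2) by (intro sum_mono member_le_sum) auto
  finally show ?thesis unfolding swap .
qed

text \<open>In the expansion of the squared modulus the diagonal pairs contribute one each. Removing
  them subtracts exactly the value \<open>d\<close> that unbiased unitaries have as squared
  overlap.\<close>

lemma sum_off_diagonal:
  fixes u :: "nat \<Rightarrow> complex"
  assumes unimod: "\<And>x. x < d \<Longrightarrow> cmod (u x) = 1"
  shows "(\<Sum>(x, y)\<in>{..<d} \<times> {..<d} - Id. u x * cnj (u y))
    = of_real ((cmod (\<Sum>x<d. u x))\<^sup>2 - real d)"
proof -
  let ?I = "{..<d} \<times> {..<d}"
  have "?I \<inter> Id = (\<lambda>x. (x, x)) ` {..<d}" by auto
  then have "(\<Sum>(x, y)\<in>?I \<inter> Id. u x * cnj (u y)) = (\<Sum>x<d. u x * cnj (u x))"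
    by (simp add: sum.reindex inj_on_def)
  also have "\<dots> = (\<Sum>x<d. 1)"
    by (rule sum.cong) (simp_all add: unimod flip: complex_norm_square)
  finally have diag: "(\<Sum>(x, y)\<in>?I \<inter> Id. u x * cnj (u y)) = of_nat d" by simp
  have "of_real ((cmod (\<Sum>x<d. u x))\<^sup>2) = (\<Sum>(x, y)\<in>?I. u x * cnj (u y))"
    by (simp add: complex_norm_square sum_product sum.cartesian_product del: of_real_power)
  also have "\<dots> = (\<Sum>(x, y)\<in>?I - Id. u x * cnj (u y)) + (\<Sum>(x, y)\<in>?I \<inter> Id. u x * cnj (u y))"
    by (subst add.commute) (rule sum.Int_Diff, simp)
  finally show ?thesis using diag by simp
qed

section \<open>Complex matrices under the Hilbert-Schmidt inner product\<close>

lemma cmat_scale_nth [simp]: "cmat_scale c A $ i $ j = c * A $ i $ j"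
  by (simp add: cmat_scale_def)

lemma cadjoint_nth [simp]: "cadjoint A $ i $ j = cnj (A $ j $ i)"
  by (simp add: cadjoint_def transpose_def)

lemma cadjoint_scale: "cadjoint (cmat_scale c A) = cmat_scale (cnj c) (cadjoint A)"
  by (simp add: vec_eq_iff)

lemma cadjoint_sum: "cadjoint (\<Sum>i\<in>I. f i) = (\<Sum>i\<in>I. cadjoint (f i))"
  by (simp add: vec_eq_iff)

lemma cadjoint_mult: "cadjoint (A ** B) = cadjoint B ** cadjoint A"
  by (simp add: vec_eq_iff matrix_matrix_mult_def mult.commute)

lemma cadjoint_mat_1 [simp]: "cadjoint (mat 1) = mat 1"
  by (simp add: vec_eq_iff mat_def)

lemma scale_mult_left: "cmat_scale c A ** B = cmat_scale c (A ** B)"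
  by (simp add: vec_eq_iff matrix_matrix_mult_def sum_distrib_left mult.assoc)

lemma scale_mult_right: "A ** cmat_scale c B = cmat_scale c (A ** B)"
  by (simp add: vec_eq_iff matrix_matrix_mult_def sum_distrib_left mult_ac)

lemma sum_mult_left: "(\<Sum>i\<in>I. f i :: complex^'n^'m) ** B = (\<Sum>i\<in>I. f i ** B)"
  by (simp add: vec_eq_iff matrix_matrix_mult_def sum_distrib_right) (intro allI sum.swap)

lemma sum_mult_right: "A ** (\<Sum>i\<in>I. f i :: complex^'n^'m) = (\<Sum>i\<in>I. A ** f i)"
  by (simp add: vec_eq_iff matrix_matrix_mult_def sum_distrib_left) (intro allI sum.swap)

lemma trace_scale: "trace (cmat_scale c A) = c * trace A"
  by (simp add: trace_def sum_distrib_left)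

lemma trace_sum: "trace (\<Sum>i\<in>I. f i :: complex^'n^'n) = (\<Sum>i\<in>I. trace (f i))"
  by (simp add: trace_def) (rule sum.swap)

lemma hs_inner_scale_right: "hs_inner A (cmat_scale c B) = c * hs_inner A B"
  by (simp add: hs_inner_def scale_mult_right trace_scale)

lemma hs_inner_scale_left: "hs_inner (cmat_scale c A) B = cnj c * hs_inner A B"
  by (simp add: hs_inner_def cadjoint_scale scale_mult_left trace_scale)

lemma hs_inner_sum_right: "hs_inner A (\<Sum>i\<in>I. f i) = (\<Sum>i\<in>I. hs_inner A (f i))"
  by (simp add: hs_inner_def sum_mult_right trace_sum)

lemma hs_inner_sum_left: "hs_inner (\<Sum>i\<in>I. f i) B = (\<Sum>i\<in>I. hs_inner (f i) B)"
  by (simp add: hs_inner_def cadjoint_sum sum_mult_left trace_sum)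

lemma hs_inner_self_unitary:
  fixes A :: "complex^'n^'n"
  assumes "unitary_mat A"
  shows "hs_inner A A = of_nat CARD('n)"
  using assms by (simp add: hs_inner_def unitary_mat_def trace_def mat_def)

text \<open>Pairing a vanishing combination with one member isolates its coefficient times the
  dimension.\<close>

lemma independent_orthogonal_unitaries:
  fixes B :: "(complex^'n^'n) set"
  assumes unitary: "\<And>A. A \<in> B \<Longrightarrow> unitary_mat A"
    and orth: "pairwise (\<lambda>A A'. hs_inner A A' = 0) B"
  shows "cmat.independent B"
proof
  assume "cmat.dependent B"
  then obtain S u A where S: "finite S" "S \<subseteq> B" "(\<Sum>M\<in>S. cmat_scale (u M) M) = 0"
      and A: "A \<in> S" "u A \<noteq> 0"
    unfolding cmat.dependent_explicit by blast
  have "0 = hs_inner A (\<Sum>M\<in>S. cmat_scale (u M) M)"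
    using S(3) hs_inner_scale_right[of A 0] by simp
  also have "\<dots> = (\<Sum>M\<in>S. if M = A then u A * of_nat CARD('n) else 0)"
    unfolding hs_inner_sum_right hs_inner_scale_right
    using S(2) A(1) hs_inner_self_unitary[OF unitary, of A] pairwiseD[OF orth, of A]
    by (intro sum.cong) auto
  also have "\<dots> = u A * of_nat CARD('n)"
    using S(1) A(1) by simp
  finally show False using A(2) by simp
qed

text \<open>Parseval's identity; the dimension appears because each basis member has squared norm
  \<open>CARD('n)\<close> instead of one. It later yields both the size of a basis and the
  unbiasedness constant.\<close>

lemma parseval_orthogonal_unitary_basis:
  fixes B :: "(complex^'n^'n) set"
  assumes B: "orthogonal_unitary_basis V B" "finite B" and "M \<in> V"
  shows "(\<Sum>A\<in>B. of_real ((cmod (hs_inner A M))\<^sup>2)) = of_nat CARD('n) * hs_inner M M"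
proof -
  have "M \<in> cmat.span B"
    using assms by (simp add: orthogonal_unitary_basis_def)
  then obtain c where M: "M = (\<Sum>A\<in>B. cmat_scale (c A) A)"
    using cmat.span_finite[OF B(2)] by auto
  have coeff: "hs_inner A M = of_nat CARD('n) * c A" if "A \<in> B" for A
  proof -
    have "hs_inner A M = (\<Sum>A'\<in>B. if A' = A then c A * of_nat CARD('n) else 0)"
      unfolding M hs_inner_sum_right hs_inner_scale_right
      using that B(1) hs_inner_self_unitary[of A]
      by (intro sum.cong) (auto simp: pairwise_def orthogonal_unitary_basis_def)
    then show ?thesis using that B(2) by simp
  qed
  have "of_nat CARD('n) * hs_inner M M = (\<Sum>A\<in>B. of_nat CARD('n) * cnj (c A) * hs_inner A M)"
    by (subst (1) M) (simp add: hs_inner_sum_left hs_inner_scale_left sum_distrib_left mult_ac)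
  also have "\<dots> = (\<Sum>A\<in>B. of_real ((cmod (hs_inner A M))\<^sup>2))"
    using coeff by (intro sum.cong) (simp_all add: complex_norm_square mult_ac del: of_real_power)
  finally show ?thesis by simp
qed


section \<open>Spectral decomposition of \<open>X\<close>\<close>

locale cyclic_unitary =
  fixes X :: "complex^'n^'n" and d :: nat
  assumes card_eq [simp]: "CARD('n) = d"
    and unitary: "unitary_mat X"
    and pow_card: "mat_pow X d = mat 1"
    and trace_pow: "\<And>k. 0 < k \<Longrightarrow> k < d \<Longrightarrow> trace (mat_pow X k) = 0"
begin

lemma d_pos [simp]: "d > 0"
  using zero_less_card_finite[where 'a = 'n] by simp

abbreviation e :: "int \<Rightarrow> complex"
  where "e \<equiv> root_char d"

text \<open>The Fourier transform of the powers of \<open>X\<close>: the spectral projection for the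
  eigenvalue \<open>e (int x)\<close>.\<close>

definition eigproj :: "nat \<Rightarrow> complex^'n^'n"
  where "eigproj x = (\<Sum>k<d. cmat_scale (e (- int x * int k) / of_nat d) (mat_pow X k))"

text \<open>Diagonal matrices in an eigenbasis of \<open>X\<close>, expressed without choosing
  eigenvectors. Only the values of \<open>a\<close> below \<open>d\<close> matter.\<close>

definition diag_mat :: "(nat \<Rightarrow> complex) \<Rightarrow> complex^'n^'n"
  where "diag_mat a = (\<Sum>x<d. cmat_scale (a x) (eigproj x))"

text \<open>Multiplication by \<open>X\<close> shifts the summation index; the cycle closes because
  both \<open>X\<close> and the character have period \<open>d\<close>.\<close>

lemma mult_eigproj: "X ** eigproj x = cmat_scale (e (int x)) (eigproj x)"
proof -
  define f where "f k = cmat_scale (e (- int x * int k) / of_nat d) (mat_pow X k)" for k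
  have "X ** eigproj x = (\<Sum>k<d. cmat_scale (e (int x)) (f (Suc k)))"
    unfolding eigproj_def sum_mult_right scale_mult_right
    by (intro sum.cong) (simp_all add: f_def algebra_simps flip: root_char_add)
  also have "\<dots> = cmat_scale (e (int x)) (\<Sum>k<d. f (Suc k))"
    by (simp add: cmat.scale_sum_right)
  also have "(\<Sum>k<d. f (Suc k)) = (\<Sum>k<d. f k) + f d - f 0"
    using sum.lessThan_Suc_shift[of f d] by (simp add: algebra_simps)
  also have "f d = f 0"
    using root_char_eq_1_iff[of d "- int x * int d"] by (simp add: f_def pow_card)
  finally show ?thesis by (simp add: f_def eigproj_def)
qed

text \<open>The adjoint of \<open>X\<close> is its inverse, so it acts on an eigenspace by the
  inverse eigenvalue.\<close>

lemma cadjoint_mat_pow_mult_eigproj: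
  "cadjoint (mat_pow X k) ** eigproj x = cmat_scale (e (- (int x * int k))) (eigproj x)"
proof (induction k)
  case (Suc k)
  have "cmat_scale (e (int x)) (cadjoint X ** eigproj x) = (cadjoint X ** X) ** eigproj x"
    by (simp add: mult_eigproj scale_mult_right flip: matrix_mul_assoc)
  also have "\<dots> = eigproj x"
    using unitary by (simp add: unitary_mat_def)
  finally have "cmat_scale (e (- int x) * e (int x)) (cadjoint X ** eigproj x)
      = cmat_scale (e (- int x)) (eigproj x)"
    by (simp flip: cmat.scale_scale)
  then have step: "cadjoint X ** eigproj x = cmat_scale (e (- int x)) (eigproj x)"
    by (simp flip: root_char_add)
  have "cadjoint (mat_pow X (Suc k)) ** eigproj x
      = cadjoint (mat_pow X k) ** (cadjoint X ** eigproj x)"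
    by (simp add: cadjoint_mult matrix_mul_assoc)
  also have "\<dots> = cmat_scale (e (- int x) * e (- (int x * int k))) (eigproj x)"
    by (simp only: step Suc scale_mult_right cmat.scale_scale)
  finally show ?case
    by (simp add: algebra_simps flip: root_char_add)
qed simp

text \<open>Expanding only the left factor leaves a character sum in \<open>y - x\<close>. The case
  \<open>x = y\<close> makes each \<open>eigproj x\<close> Hermitian and idempotent.\<close>

lemma cadjoint_eigproj_mult_eigproj:
  assumes "x < d" "y < d"
  shows "cadjoint (eigproj y) ** eigproj x = (if x = y then eigproj x else 0)"
proof -
  have "cadjoint (eigproj y) ** eigproj x
      = (\<Sum>k<d. cmat_scale (e ((int y - int x) * int k) / of_nat d) (eigproj x))"
    unfolding eigproj_def[of y] cadjoint_sum sum_mult_left cadjoint_scale scale_mult_left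
      cadjoint_mat_pow_mult_eigproj
    by (intro sum.cong) (simp_all add: cnj_root_char algebra_simps flip: root_char_add)
  also have "\<dots> = cmat_scale (if y = x then 1 else 0) (eigproj x)"
    using assms sum_root_char_diff[of y d x]
    by (simp flip: cmat.scale_sum_left sum_divide_distrib)
  finally show ?thesis by auto
qed

text \<open>Fourier inversion; the case \<open>k = 0\<close> resolves the identity into the
  projections.\<close>

lemma mat_pow_eq_diag_mat:
  assumes "k < d"
  shows "mat_pow X k = diag_mat (\<lambda>x. e (int x * int k))"
proof -
  have "diag_mat (\<lambda>x. e (int x * int k))
      = (\<Sum>x<d. \<Sum>j<d. cmat_scale (e ((int k - int j) * int x) / of_nat d) (mat_pow X j))"
    unfolding diag_mat_def eigproj_def cmat.scale_sum_right cmat.scale_scale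
    by (intro sum.cong) (simp_all add: algebra_simps flip: root_char_add)
  also have "\<dots> = (\<Sum>j<d. cmat_scale ((\<Sum>x<d. e ((int k - int j) * int x)) / of_nat d) (mat_pow X j))"
    by (subst sum.swap) (simp add: sum_divide_distrib cmat.scale_sum_left)
  also have "\<dots> = (\<Sum>j<d. if j = k then mat_pow X k else 0)"
    using assms by (intro sum.cong) (auto simp: sum_root_char_diff)
  finally show ?thesis using assms by simp
qed

lemma diag_mat_1: "diag_mat (\<lambda>x. 1) = mat 1"
  using mat_pow_eq_diag_mat[of 0] by simp

text \<open>Only the zeroth power of \<open>X\<close> has a nonzero trace. Hence every
  \<open>d\<close>-th root of unity is a simple eigenvalue.\<close>

lemma trace_eigproj: "trace (eigproj x) = 1"
proof -
  have "trace (eigproj x) = (\<Sum>k<d. if k = 0 then 1 else 0)"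
    unfolding eigproj_def trace_sum trace_scale
    using trace_pow by (intro sum.cong) (auto simp: trace_def mat_def)
  then show ?thesis by simp
qed

lemma trace_diag_mat: "trace (diag_mat a) = (\<Sum>x<d. a x)"
  by (simp add: diag_mat_def trace_sum trace_scale trace_eigproj)

lemma cadjoint_diag_mat_mult:
  "cadjoint (diag_mat a) ** diag_mat b = diag_mat (\<lambda>x. cnj (a x) * b x)"
proof -
  have "cadjoint (diag_mat a) ** diag_mat b
      = (\<Sum>x<d. \<Sum>y<d. if y = x then cmat_scale (cnj (a x) * b x) (eigproj x) else 0)"
    unfolding diag_mat_def cadjoint_sum sum_mult_left sum_mult_right cadjoint_scale
      scale_mult_left scale_mult_right cmat.scale_sum_right
    by (intro sum.cong) (auto simp: cadjoint_eigproj_mult_eigproj mult.commute)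
  then show ?thesis by (simp add: diag_mat_def)
qed

text \<open>Since the projections have trace one, diagonals carry the standard inner product of
  d-dimensional complex space.\<close>

lemma hs_inner_diag_mat: "hs_inner (diag_mat a) (diag_mat b) = (\<Sum>x<d. cnj (a x) * b x)"
  by (simp add: hs_inner_def cadjoint_diag_mat_mult trace_diag_mat)

lemma eigproj_eq_diag_mat:
  assumes "x < d"
  shows "eigproj x = diag_mat (\<lambda>y. if y = x then 1 else 0)"
proof -
  have "diag_mat (\<lambda>y. if y = x then 1 else 0) = (\<Sum>y<d. if y = x then eigproj x else 0)"
    unfolding diag_mat_def by (intro sum.cong) auto
  then show ?thesis using assms by simp
qed

lemma hs_inner_eigproj_diag_mat:
  assumes "x < d"
  shows "hs_inner (eigproj x) (diag_mat a) = a x"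
proof -
  have "hs_inner (eigproj x) (diag_mat a) = (\<Sum>y<d. if y = x then a x else 0)"
    unfolding eigproj_eq_diag_mat[OF assms] hs_inner_diag_mat by (intro sum.cong) auto
  then show ?thesis using assms by simp
qed

lemma unitary_diag_mat_iff: "unitary_mat (diag_mat a) \<longleftrightarrow> (\<forall>x<d. cmod (a x) = 1)"
proof
  assume "unitary_mat (diag_mat a)"
  then have eq: "diag_mat (\<lambda>x. cnj (a x) * a x) = diag_mat (\<lambda>x. 1)"
    by (simp add: unitary_mat_def cadjoint_diag_mat_mult diag_mat_1)
  show "\<forall>x<d. cmod (a x) = 1"
  proof (intro allI impI)
    fix x assume "x < d"
    then have "cnj (a x) * a x = 1"
      \<comment> \<open>Pairing both sides with a projection compares their diagonal entries at
        \<open>x\<close>.\<close>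
      using arg_cong[OF eq, of "hs_inner (eigproj x)"] by (simp add: hs_inner_eigproj_diag_mat)
    then have "complex_of_real ((cmod (a x))\<^sup>2) = of_real 1"
      by (simp add: complex_norm_square mult.commute del: of_real_power)
    then show "cmod (a x) = 1"
      unfolding of_real_eq_iff by (simp add: power2_eq_1_iff) (use norm_ge_zero[of "a x"] in linarith)
  qed
next
  assume unimod: "\<forall>x<d. cmod (a x) = 1"
  have "diag_mat (\<lambda>x. cnj (a x) * a x) = diag_mat (\<lambda>x. 1)"
    unfolding diag_mat_def using unimod
    by (intro sum.cong) (auto simp: mult.commute[of "cnj _"] simp flip: complex_norm_square)
  then have "cadjoint (diag_mat a) ** diag_mat a = mat 1"
    by (simp add: cadjoint_diag_mat_mult diag_mat_1)
  then show "unitary_mat (diag_mat a)"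
    using matrix_left_right_inverse by (auto simp: unitary_mat_def)
qed

lemma diag_mat_in_subspace:
  assumes "cmat.subspace S" "\<And>x. x < d \<Longrightarrow> eigproj x \<in> S"
  shows "diag_mat a \<in> S"
  unfolding diag_mat_def using assms by (intro cmat.subspace_sum cmat.subspace_scale) auto

lemma subspace_range_diag_mat: "cmat.subspace (range diag_mat)"
proof (rule cmat.subspaceI)
  show "0 \<in> range diag_mat"
    by (rule range_eqI[of _ _ "\<lambda>x. 0"]) (simp add: diag_mat_def)
next
  fix A B assume "A \<in> range diag_mat" "B \<in> range diag_mat"
  then obtain a b where "A = diag_mat a" "B = diag_mat b" by auto
  then show "A + B \<in> range diag_mat"
    by (intro range_eqI[of _ _ "\<lambda>x. a x + b x"])
      (simp add: diag_mat_def cmat.scale_left_distrib sum.distrib)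
next
  fix c A assume "A \<in> range diag_mat"
  then obtain a where "A = diag_mat a" by auto
  then show "cmat_scale c A \<in> range diag_mat"
    by (intro range_eqI[of _ _ "\<lambda>x. c * a x"]) (simp add: diag_mat_def cmat.scale_sum_right)
qed

text \<open>Powers of \<open>X\<close> are diagonal by Fourier inversion, and each projection is by
  definition a combination of powers.\<close>

lemma power_span_eq: "power_span X = range diag_mat"
proof
  show "power_span X \<subseteq> range diag_mat"
    unfolding power_span_def
    by (rule cmat.span_minimal[OF _ subspace_range_diag_mat]) (auto simp: mat_pow_eq_diag_mat)
  have "eigproj x \<in> power_span X" for x
    unfolding power_span_def eigproj_def
    by (intro cmat.span_sum cmat.span_scale cmat.span_base) auto
  then show "range diag_mat \<subseteq> power_span X"
    by (auto intro!: diag_mat_in_subspace simp: power_span_def)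
qed

text \<open>Gives every matrix of the span a canonical diagonal. The proof compares sums because the
  two diagonals need agree only below \<open>d\<close>.\<close>

lemma diag_mat_hs_inner_eigproj:
  assumes "M \<in> power_span X"
  shows "diag_mat (\<lambda>x. hs_inner (eigproj x) M) = M"
proof -
  obtain a where M: "M = diag_mat a"
    using assms by (auto simp: power_span_eq)
  have "diag_mat (\<lambda>x. hs_inner (eigproj x) M) = (\<Sum>x<d. cmat_scale (a x) (eigproj x))"
    unfolding M diag_mat_def[of "\<lambda>x. hs_inner (eigproj x) (diag_mat a)"]
    by (intro sum.cong) (simp_all add: hs_inner_eigproj_diag_mat)
  then show ?thesis
    by (simp only: M diag_mat_def[of a])
qed

section \<open>Construction of \<open>d\<close> bases from quadratic phases\<close>

text \<open>\<open>k\<close> labels the basis and \<open>j\<close> its member; for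
  \<open>k = 0\<close> and \<open>j < d\<close> these are the powers of \<open>X\<close>.\<close>

definition quad_mat :: "nat \<Rightarrow> nat \<Rightarrow> complex^'n^'n"
  where "quad_mat k j = diag_mat (\<lambda>x. e (int k * int x ^ 2 + int j * int x))"

lemma hs_inner_quad_mat:
  "hs_inner (quad_mat k j) (quad_mat k' j')
    = (\<Sum>x<d. e ((int k' - int k) * int x ^ 2 + (int j' - int j) * int x))"
  unfolding quad_mat_def hs_inner_diag_mat
  by (intro sum.cong) (simp_all add: cnj_root_char algebra_simps flip: root_char_add)

text \<open>Within one basis the quadratic phases cancel in inner products, so orthogonality is that
  of characters.\<close>

lemma orthogonal_unitary_basis_quad_mat:
  "orthogonal_unitary_basis (power_span X) (quad_mat k ` {..<d})"
proof -
  let ?B = "quad_mat k ` {..<d}"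
  have unitary: "unitary_mat A" if "A \<in> ?B" for A
    using that by (auto simp: quad_mat_def unitary_diag_mat_iff)
  have orth: "pairwise (\<lambda>A A'. hs_inner A A' = 0) ?B"
    by (rule pairwiseI) (auto simp: hs_inner_quad_mat sum_root_char_diff)
  have "eigproj y \<in> cmat.span ?B" if "y < d" for y
  proof -
    define q where "q x = int k * int x ^ 2" for x
    \<comment> \<open>The coefficients are the conjugated entries of \<open>quad_mat k j\<close> at
      \<open>y\<close>, divided by \<open>d\<close>; summing over \<open>j\<close> keeps only the
      projection at \<open>y\<close>.\<close>
    have "(\<Sum>j<d. cmat_scale (e (- (q y + int j * int y)) / of_nat d) (quad_mat k j))
        = (\<Sum>j<d. \<Sum>x<d. cmat_scale (e (q x - q y) * e ((int x - int y) * int j) / of_nat d) (eigproj x))"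
      unfolding quad_mat_def diag_mat_def cmat.scale_sum_right cmat.scale_scale
      by (intro sum.cong) (simp_all add: q_def algebra_simps flip: root_char_add)
    also have "\<dots> = (\<Sum>x<d. cmat_scale (e (q x - q y) * (\<Sum>j<d. e ((int x - int y) * int j)) / of_nat d) (eigproj x))"
      by (subst sum.swap) (simp add: sum_divide_distrib sum_distrib_left cmat.scale_sum_left)
    also have "\<dots> = (\<Sum>x<d. if x = y then eigproj y else 0)"
      using that by (intro sum.cong) (auto simp: sum_root_char_diff)
    also have "\<dots> = eigproj y"
      using that by simp
    finally show ?thesis
      by (metis (no_types, lifting) cmat.span_sum cmat.span_scale cmat.span_base imageI)
  qed
  then have "range diag_mat \<subseteq> cmat.span ?B"
    by (auto intro!: diag_mat_in_subspace)
  moreover have "cmat.span ?B \<subseteq> range diag_mat"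
    by (rule cmat.span_minimal[OF _ subspace_range_diag_mat]) (auto simp: quad_mat_def)
  ultimately have "cmat.span ?B = power_span X"
    by (auto simp: power_span_eq)
  then show ?thesis
    using independent_orthogonal_unitaries[OF unitary orth] unitary orth
    by (simp add: orthogonal_unitary_basis_def)
qed

text \<open>The overlap is a Gauss sum with leading coefficient \<open>k' - k\<close>. Twice this
  coefficient is invertible modulo \<open>d\<close>, as \<open>d\<close> is an odd prime and the
  labels differ modulo \<open>d\<close>.\<close>

lemma norm_hs_inner_quad_mat:
  assumes "prime d" "d > 2" "k < d" "k' < d" "k \<noteq> k'"
  shows "(cmod (hs_inner (quad_mat k j) (quad_mat k' j')))\<^sup>2 = real d"
proof -
  have "\<not> int d dvd 2"
    using assms(2) zdvd_not_zless[of 2 "int d"] by simp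
  moreover have "\<not> int d dvd int k' - int k"
    using assms by (auto simp flip: mod_eq_dvd_iff)
  ultimately have "\<not> int d dvd 2 * (int k' - int k)"
    using assms(1) by (subst prime_dvd_mult_iff) simp_all
  then have "coprime (int d) (2 * (int k' - int k))"
    using assms(1) by (intro prime_imp_coprime) auto
  then show ?thesis
    unfolding hs_inner_quad_mat by (intro gauss_sum_norm) simp_all
qed

lemma ex_muub_family:
  assumes "prime d" "d > 2"
  shows "\<exists>F. muub_family (power_span X) F \<and> finite F \<and> card F = d"
proof -
  define B where "B k = quad_mat k ` {..<d}" for k
  have basis: "orthogonal_unitary_basis (power_span X) (B k)" for k
    unfolding B_def by (rule orthogonal_unitary_basis_quad_mat)
  have unbiased: "(cmod (hs_inner A A'))\<^sup>2 = real d"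
    if "k < d" "k' < d" "k \<noteq> k'" "A \<in> B k" "A' \<in> B k'" for k k' A A'
    using that norm_hs_inner_quad_mat[OF assms] by (auto simp: B_def)
  \<comment> \<open>A common member would have squared overlap \<open>d^2\<close> with itself by
    unitarity, but \<open>d\<close> by unbiasedness.\<close>
  have distinct: "B k \<noteq> B k'" if "k < d" "k' < d" "k \<noteq> k'" for k k'
  proof
    assume "B k = B k'"
    then have A: "quad_mat k 0 \<in> B k" "quad_mat k 0 \<in> B k'"
      using B_def by auto
    then have "hs_inner (quad_mat k 0) (quad_mat k 0) = of_nat d"
      using basis[of k] hs_inner_self_unitary[of "quad_mat k 0"]
      by (auto simp: orthogonal_unitary_basis_def)
    then have "real d ^ 2 = real d"
      using unbiased[OF that A] by simp
    then show False
      using assms(2) by (simp add: power2_eq_square)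
  qed
  have "inj_on B {..<d}"
    using distinct by (auto simp: inj_on_def)
  moreover have "muub (power_span X) (B k) (B k')" if "k < d" "k' < d" "k \<noteq> k'" for k k'
    unfolding muub_def using basis distinct[OF that] unbiased[OF that] assms(2)
    by (auto intro!: exI[of _ "real d"])
  then have "muub_family (power_span X) (B ` {..<d})"
    unfolding muub_family_def pairwise_def using basis by auto
  ultimately show ?thesis
    by (intro exI[of _ "B ` {..<d}"]) (simp add: card_image)
qed

section \<open>Upper bound on the size of a family\<close>

lemma basis_unimodular:
  assumes "orthogonal_unitary_basis (power_span X) B" "A \<in> B" "x < d"
  shows "cmod (hs_inner (eigproj x) A) = 1"
proof -
  have "unitary_mat A" "A \<in> power_span X"
    using assms cmat.span_base[of A B] by (auto simp: orthogonal_unitary_basis_def)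
  then show ?thesis
    using unitary_diag_mat_iff[of "\<lambda>x. hs_inner (eigproj x) A"] assms(3)
    by (simp add: diag_mat_hs_inner_eigproj)
qed

text \<open>Finiteness comes from independence inside a finitely spanned space. The size comes from
  Parseval applied to \<open>eigproj 0\<close>, which has norm one and overlap of modulus one with
  every unitary of the span.\<close>

lemma basis_card:
  assumes "orthogonal_unitary_basis (power_span X) B"
  shows "finite B \<and> card B = d"
proof -
  have "B \<subseteq> cmat.span (mat_pow X ` {..<d})"
    using assms cmat.span_superset[of B] by (simp add: orthogonal_unitary_basis_def power_span_def)
  then have fin: "finite B"
    using assms cmat.independent_span_bound[of "mat_pow X ` {..<d}" B]
    by (simp add: orthogonal_unitary_basis_def)
  have P: "eigproj 0 \<in> power_span X"
    by (simp add: power_span_eq eigproj_eq_diag_mat)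
  have "cmod (hs_inner A (eigproj 0)) = 1" if "A \<in> B" for A
  proof -
    have "A \<in> power_span X"
      using assms that cmat.span_base[of A B] by (auto simp: orthogonal_unitary_basis_def)
    then obtain a where "A = diag_mat a" by (auto simp: power_span_eq)
    moreover have "cmod (hs_inner (eigproj 0) A) = 1"
      using basis_unimodular[OF assms that] by simp
    ultimately have "cmod (a 0) = 1"
      by (simp add: hs_inner_eigproj_diag_mat)
    then show ?thesis
      unfolding \<open>A = _\<close> eigproj_eq_diag_mat[of 0, simplified] hs_inner_diag_mat
      by (simp add: if_distrib cong: if_cong)
  qed
  then have "of_nat (card B) = of_nat d * hs_inner (eigproj 0) (eigproj 0)"
    using parseval_orthogonal_unitary_basis[OF assms fin P] by simp
  also have "hs_inner (eigproj 0) (eigproj 0) = 1"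
    by (simp add: hs_inner_def cadjoint_eigproj_mult_eigproj trace_eigproj)
  finally show ?thesis using fin by simp
qed

text \<open>Parseval for \<open>A'\<close> in the basis \<open>B\<close> adds \<open>d\<close>
  copies of the constant \<open>C\<close> to a total of \<open>d * d\<close>, which forces
  \<open>C = d\<close>.\<close>

lemma muub_norm:
  assumes muub: "muub (power_span X) B B'" and "A \<in> B" "A' \<in> B'"
  shows "(cmod (hs_inner A A'))\<^sup>2 = real d"
proof -
  from muub obtain C where C: "\<And>A A'. A \<in> B \<Longrightarrow> A' \<in> B' \<Longrightarrow> (cmod (hs_inner A A'))\<^sup>2 = C"
    unfolding muub_def by blast
  have B: "orthogonal_unitary_basis (power_span X) B" and
    A': "A' \<in> power_span X" "unitary_mat A'"
    using muub assms(3) cmat.span_base[of A' B'] by (auto simp: muub_def orthogonal_unitary_basis_def)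
  have "(\<Sum>A\<in>B. complex_of_real ((cmod (hs_inner A A'))\<^sup>2)) = of_nat d * of_nat d"
    using basis_card[OF B] A' hs_inner_self_unitary[OF A'(2), unfolded card_eq]
    by (subst parseval_orthogonal_unitary_basis[OF B, unfolded card_eq]) auto
  then have "of_nat d * complex_of_real C = of_nat d * of_nat d"
    using C assms(3) basis_card[OF B] by (simp del: of_real_power)
  then have "complex_of_real C = of_real (real d)"
    using d_pos by (auto simp del: d_pos)
  then show ?thesis
    using C[OF assms(2,3)] unfolding of_real_eq_iff by simp
qed

text \<open>With \<open>u x\<close> the product of the conjugated entry of \<open>A\<close> and the
  entry of \<open>A'\<close> at \<open>x\<close>, each summand is \<open>u x * cnj (u y)\<close> and
  the sum of \<open>u\<close> is the overlap.\<close>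

lemma off_diagonal_gram:
  assumes basis: "orthogonal_unitary_basis (power_span X) B" "orthogonal_unitary_basis (power_span X) B'"
    and A: "A \<in> B" "A' \<in> B'"
  defines "v \<equiv> \<lambda>A (x, y). hs_inner (eigproj x) A * cnj (hs_inner (eigproj y) A)"
  shows "(\<Sum>p\<in>{..<d} \<times> {..<d} - Id. cnj (v A p) * v A' p)
    = of_real ((cmod (hs_inner A A'))\<^sup>2 - real d)"
proof -
  define u where "u x = cnj (hs_inner (eigproj x) A) * hs_inner (eigproj x) A'" for x
  have "A \<in> power_span X" "A' \<in> power_span X"
    using basis A cmat.span_base[of A B] cmat.span_base[of A' B']
    by (auto simp: orthogonal_unitary_basis_def)
  then have "hs_inner A A' = (\<Sum>x<d. u x)"
    unfolding u_def
    using hs_inner_diag_mat[of "\<lambda>x. hs_inner (eigproj x) A" "\<lambda>x. hs_inner (eigproj x) A'"]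
    by (simp add: diag_mat_hs_inner_eigproj)
  moreover have "cmod (u x) = 1" if "x < d" for x
    using that basis A by (simp add: u_def norm_mult basis_unimodular)
  then have "(\<Sum>(x, y)\<in>{..<d} \<times> {..<d} - Id. u x * cnj (u y))
      = of_real ((cmod (\<Sum>x<d. u x))\<^sup>2 - real d)"
    by (rule sum_off_diagonal)
  moreover have "(\<Sum>p\<in>{..<d} \<times> {..<d} - Id. cnj (v A p) * v A' p)
      = (\<Sum>(x, y)\<in>{..<d} \<times> {..<d} - Id. u x * cnj (u y))"
    by (intro sum.cong) (auto simp: v_def u_def mult_ac)
  ultimately show ?thesis by simp
qed

lemma finite_muub_family_card_le:
  assumes d: "d > 1" and F: "muub_family (power_span X) F" "finite F"
  shows "card F \<le> d"
proof -
  \<comment> \<open>Tagging each unitary with its basis keeps the bases formally disjoint, so this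
    set has \<open>card F * d\<close> elements.\<close>
  let ?I = "SIGMA B:F. B"
  let ?P = "{..<d} \<times> {..<d} - Id"
  define v where "v A = (\<lambda>(x, y). hs_inner (eigproj x) A * cnj (hs_inner (eigproj y) A))" for A
  define w where "w A A' = ((cmod (hs_inner A A'))\<^sup>2 - real d)\<^sup>2"
    for A A' :: "complex^'n^'n"
  have basis: "orthogonal_unitary_basis (power_span X) B" if "B \<in> F" for B
    using F that by (simp add: muub_family_def)
  have card: "finite B" "card B = d" if "B \<in> F" for B
    using basis_card[OF basis[OF that]] by auto
  have w_same: "w A A' = (if A' = A then (real d ^ 2 - real d)\<^sup>2 else real d ^ 2)"
    if "B \<in> F" "A \<in> B" "A' \<in> B" for A A' B
    using that basis[OF that(1)] hs_inner_self_unitary[of A, unfolded card_eq]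
    by (auto simp: w_def orthogonal_unitary_basis_def pairwise_def)
  have w_other: "w A A' = 0" if "B \<in> F" "B' \<in> F" "B \<noteq> B'" "A \<in> B" "A' \<in> B'" for A A' B B'
  proof -
    have "muub (power_span X) B B'"
      using F(1) that by (auto simp: muub_family_def pairwise_def)
    then show ?thesis using muub_norm that by (simp add: w_def)
  qed
  \<comment> \<open>A row total: one entry from the unitary itself, \<open>d - 1\<close> from the
    rest of its basis, and zero from all other bases.\<close>
  let ?K = "(real d ^ 2 - real d)\<^sup>2 + (real d - 1) * real d ^ 2"
  have row: "(\<Sum>B'\<in>F. \<Sum>A'\<in>B'. w A A') = ?K" if "B \<in> F" "A \<in> B" for B A
  proof -
    have "(\<Sum>B'\<in>F. \<Sum>A'\<in>B'. w A A') = (\<Sum>B'\<in>F. if B' = B then \<Sum>A'\<in>B. w A A' else 0)"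
      using w_other[OF that(1)] that by (intro sum.cong) (auto intro!: sum.neutral)
    also have "\<dots> = (\<Sum>A'\<in>B. w A A')"
      using that F(2) by simp
    also have "\<dots> = w A A + (\<Sum>A'\<in>B - {A}. w A A')"
      using that card by (intro sum.remove) auto
    also have "\<dots> = (real d ^ 2 - real d)\<^sup>2 + (\<Sum>A'\<in>B - {A}. real d ^ 2)"
      using that w_same by simp
    also have "\<dots> = ?K"
      using that card d by (simp add: of_nat_diff)
    finally show ?thesis .
  qed
  have sum_I: "(\<Sum>i\<in>?I. f (snd i)) = (\<Sum>B\<in>F. \<Sum>A\<in>B. f A)" for f :: "complex^'n^'n \<Rightarrow> real"
    using F(2) card by (simp add: sum.Sigma case_prod_unfold)
  have cardI: "card ?I = card F * d"
    using card F(2) by simp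
  have "?P = {..<d} \<times> {..<d} - (\<lambda>x. (x, x)) ` {..<d}" by auto
  then have "card ?P = d * d - d"
    by (simp only:) (subst card_Diff_subset, auto simp: card_image inj_on_def)
  then have cardP: "real (card ?P) = real d ^ 2 - real d"
    using d by (simp add: of_nat_diff power2_eq_square)
  have unimod: "cmod (v (snd i) p) = 1" if "i \<in> ?I" "p \<in> ?P" for i p
  proof -
    have "cmod (hs_inner (eigproj x) (snd i)) = 1" if "x < d" for x
      using basis_unimodular[OF basis[of "fst i"], of "snd i"] \<open>i \<in> ?I\<close> that by auto
    then show ?thesis
      using that(2) by (auto simp: v_def norm_mult)
  qed
  have "real (card ?P) * (real (card ?I))\<^sup>2
      \<le> (\<Sum>i\<in>?I. \<Sum>j\<in>?I. (cmod (\<Sum>p\<in>?P. cnj (v (snd i) p) * v (snd j) p))\<^sup>2)"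
    using F(2) card unimod by (intro sum_cmod_gram_ge) auto
  also have "\<dots> = (\<Sum>i\<in>?I. \<Sum>j\<in>?I. w (snd i) (snd j))"
  proof (intro sum.cong refl)
    fix i j assume "i \<in> ?I" "j \<in> ?I"
    then have "(\<Sum>p\<in>?P. cnj (v (snd i) p) * v (snd j) p)
        = of_real ((cmod (hs_inner (snd i) (snd j)))\<^sup>2 - real d)"
      unfolding v_def by (intro off_diagonal_gram[of "fst i" "fst j"] basis) auto
    then show "(cmod (\<Sum>p\<in>?P. cnj (v (snd i) p) * v (snd j) p))\<^sup>2 = w (snd i) (snd j)"
      by (simp only: norm_of_real power2_abs w_def)
  qed
  also have "\<dots> = (\<Sum>B\<in>F. \<Sum>A\<in>B. \<Sum>B'\<in>F. \<Sum>A'\<in>B'. w A A')"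
    using sum_I[of "\<lambda>A. \<Sum>B'\<in>F. \<Sum>A'\<in>B'. w A A'"] by (simp only: sum_I)
  also have "\<dots> = real (card F) * real d * ?K"
    using row card by simp
  finally have "(real d ^ 2 - real d) * (real (card F) * real d)\<^sup>2 \<le> real (card F) * real d * ?K"
    by (simp only: cardI cardP of_nat_mult)
  \<comment> \<open>\<open>?K\<close> equals \<open>d^3 * (d - 1)\<close>, so both sides share a
    factor that is positive unless \<open>F\<close> is empty.\<close>
  moreover have "(real d ^ 2 - real d) * (real (card F) * real d)\<^sup>2
      = (real d ^ 3 * (real d - 1) * real (card F)) * real (card F)"
    "real (card F) * real d * ?K = (real d ^ 3 * (real d - 1) * real (card F)) * real d"
    by (simp_all add: power2_eq_square power3_eq_cube algebra_simps)
  ultimately have "(real d ^ 3 * (real d - 1) * real (card F)) * real (card F)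
      \<le> (real d ^ 3 * (real d - 1) * real (card F)) * real d"
    by simp
  then show ?thesis
    using d by (cases "card F = 0") (simp_all add: mult_le_cancel_left)
qed

text \<open>Subfamilies inherit the pairwise condition, so all finite ones obey the same bound; this
  rules out an infinite family.\<close>

lemma muub_family_card_le:
  assumes "d > 1" "muub_family (power_span X) F"
  shows "finite F \<and> card F \<le> d"
proof (rule finite_if_finite_subsets_card_bdd)
  fix G assume "G \<subseteq> F" "finite G"
  then show "card G \<le> d"
    using assms pairwise_subset[of "muub (power_span X)" F G]
    by (intro finite_muub_family_card_le) (auto simp: muub_family_def)
qed

end

theorem theorem10:
  fixes X :: "complex^'n^'n"
  assumes "prime CARD('n)" and "CARD('n) > 2"
    and "unitary_mat X"
    and "mat_pow X CARD('n) = mat 1"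
    and "\<And>i j. i < CARD('n) \<Longrightarrow> j < CARD('n) \<Longrightarrow> i \<noteq> j \<Longrightarrow>
           trace (mat_pow X i ** cadjoint (mat_pow X j)) = 0"
  shows "(\<exists>F. muub_family (power_span X) F \<and> finite F \<and> card F = CARD('n)) \<and>
         (\<forall>F. muub_family (power_span X) F \<longrightarrow> finite F \<and> card F \<le> CARD('n))"
proof -
  \<comment> \<open>Taking \<open>j = 0\<close> in the trace hypothesis turns the second factor into
    the identity and leaves the trace of a single power.\<close>
  have X: "cyclic_unitary X CARD('n)"
    using assms(3,4) assms(5)[of _ 0] by unfold_locales (simp_all del: One_nat_def)
  show ?thesis
    using cyclic_unitary.ex_muub_family[OF X] cyclic_unitary.muub_family_card_le[OF X] assms(1,2)
    by simp
qed

end
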